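(* Let $Q$ be a non-zero TF-compatible information quantity on $\mathsf N$ parties. Then $Q$ is not $R$-balanced for any $R\ge 3$.
   Context: Let $[\mathsf N]=\{1,\dots,\mathsf N\}$ be the set of parties. An information quantity is a formal linear combination $Q=\sum_{\emptyset\ne X\subseteq[\mathsf N]}q_X\,S(X)$ of independent symbols $S(X)$, one per non-empty subsystem $X\subseteq[\mathsf N]$, with $S(\emptyset)=0$. Juxtaposition of subsystems denotes union. For pairwise disjoint $X,Y,Z,W\subseteq[\mathsf N]$, $$I_3(X:Y:Z\,|\,W)=S(XW)+S(YW)+S(ZW)+S(XYZW)-S(XYW)-S(XZW)-S(YZW)-S(W).$$ $Q$ is TF-compatible if it equals a finite sum $\sum_i -I_3(X_i:Y_i:Z_i\,|\,W_i)$ with, for each $i$, $X_i,Y_i,Z_i,W_i\subseteq[\mathsf N]$ pairwise disjoint ($W_i=\emptyset$ allowed; repeated terms allowed). I-basis: for non-empty $J\subseteq[\mathsf N]$ let $\mathtt I_J=\sum_{\emptyset\ne K\subseteq J}(-1)^{|K|+1}S(K)$ (the multipartite information of the individual parties in $J$). These form a basis of the space of information quantities, so $Q=\sum_{\emptyset\neq J\subseteq[\mathsf N]}r_J\,\mathtt I_J$ for unique coefficients $r_J$. $Q$ is $R$-balanced if $r_J=0$ for all $J$ with $|J|\le R$. *)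

theory Defs
  imports Complex_Main "HOL-Library.Poly_Mapping"
begin

definition parties :: "nat \<Rightarrow> nat set" where
  "parties N = {1..N}"

definition subsystems :: "nat set \<Rightarrow> nat set set" where
  "subsystems A = {X. X \<subseteq> A \<and> X \<noteq> {}}"

text \<open>Formal linear combinations of independent symbols, one per subsystem, are finitely
  supported functions from sets of parties to the reals.\<close>

type_synonym info_comb = "nat set \<Rightarrow>\<^sub>0 real"

definition info_quantity :: "nat \<Rightarrow> info_comb \<Rightarrow> bool" where
  "info_quantity N Q \<longleftrightarrow> Poly_Mapping.keys Q \<subseteq> subsystems (parties N)"

definition S :: "nat set \<Rightarrow> info_comb" where
  "S X = (if X = {} then 0 else Poly_Mapping.single X 1)"

text \<open>The library has no scalar multiplication on finitely supported functions for
  an arbitrary key type.\<close>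

definition scale :: "real \<Rightarrow> info_comb \<Rightarrow> info_comb" where
  "scale c Q = Poly_Mapping.map (\<lambda>x. c * x) Q"

definition I3 :: "nat set \<Rightarrow> nat set \<Rightarrow> nat set \<Rightarrow> nat set \<Rightarrow> info_comb" where
  "I3 X Y Z W =
     S (X \<union> W) + S (Y \<union> W) + S (Z \<union> W) + S (X \<union> Y \<union> Z \<union> W)
     - S (X \<union> Y \<union> W) - S (X \<union> Z \<union> W) - S (Y \<union> Z \<union> W) - S W"

definition I3_admissible ::
    "nat \<Rightarrow> nat set \<Rightarrow> nat set \<Rightarrow> nat set \<Rightarrow> nat set \<Rightarrow> bool" where
  "I3_admissible N X Y Z W \<longleftrightarrow>
     X \<subseteq> parties N \<and> Y \<subseteq> parties N \<and> Z \<subseteq> parties N \<and> W \<subseteq> parties N \<and>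
     X \<inter> Y = {} \<and> X \<inter> Z = {} \<and> X \<inter> W = {} \<and> Y \<inter> Z = {} \<and> Y \<inter> W = {} \<and> Z \<inter> W = {}"

text \<open>Empty arguments are permitted; the corresponding terms vanish if \<open>X\<close>, \<open>Y\<close> or \<open>Z\<close>
  is empty.\<close>

definition TF_compatible :: "nat \<Rightarrow> info_comb \<Rightarrow> bool" where
  "TF_compatible N Q \<longleftrightarrow>
     (\<exists>ts. (\<forall>(X, Y, Z, W) \<in> set ts. I3_admissible N X Y Z W) \<and>
           Q = (\<Sum>(X, Y, Z, W) \<leftarrow> ts. - I3 X Y Z W))"

definition I_basis :: "nat set \<Rightarrow> info_comb" where
  "I_basis J = (\<Sum>K\<in>subsystems J. scale ((-1) ^ (card K + 1)) (S K))"

definition is_I_expansion :: "nat \<Rightarrow> info_comb \<Rightarrow> (nat set \<Rightarrow> real) \<Rightarrow> bool" where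
  "is_I_expansion N Q r \<longleftrightarrow>
     (\<forall>J. J \<notin> subsystems (parties N) \<longrightarrow> r J = 0) \<and>
     Q = (\<Sum>J\<in>subsystems (parties N). scale (r J) (I_basis J))"

text \<open>Existence and uniqueness of the coefficients is lemma \<open>I_expansion_ex1\<close> below.\<close>

definition I_coeff :: "nat \<Rightarrow> info_comb \<Rightarrow> nat set \<Rightarrow> real" where
  "I_coeff N Q = (THE r. is_I_expansion N Q r)"

definition R_balanced :: "nat \<Rightarrow> nat \<Rightarrow> info_comb \<Rightarrow> bool" where
  "R_balanced N R Q \<longleftrightarrow>
     (\<forall>J\<in>subsystems (parties N). card J \<le> R \<longrightarrow> I_coeff N Q J = 0)"

lemma finite_parties [simp]: "finite (parties N)"
  by (simp add: parties_def)

lemma finite_subsystems [simp]: "finite A \<Longrightarrow> finite (subsystems A)"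
  by (simp add: subsystems_def)

lemma lookup_scale [simp]:
  "Poly_Mapping.lookup (scale c Q) K = c * Poly_Mapping.lookup Q K"
  by (simp add: scale_def map.rep_eq when_def)

lemma lookup_S:
  "Poly_Mapping.lookup (S X) K = (if X = K \<and> X \<noteq> {} then 1 else 0)"
  by (auto simp: S_def lookup_single when_def)

lemma lookup_I_basis:
  assumes "finite J"
  shows "Poly_Mapping.lookup (I_basis J) K =
    (if K \<in> subsystems J then (-1) ^ (card K + 1) else 0)"
proof -
  have "Poly_Mapping.lookup (I_basis J) K =
      (\<Sum>L\<in>subsystems J. if L = K then (-1) ^ (card K + 1) else 0)"
    unfolding I_basis_def lookup_sum
    by (rule sum.cong) (auto simp: lookup_S subsystems_def)
  then show ?thesis
    using assms by simp
qed

lemma S_eq_sum_I_basis: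
  assumes "finite K"
  shows "S K = (\<Sum>J\<in>subsystems K. scale ((-1) ^ (card J + 1)) (I_basis J))"
proof (rule poly_mapping_eqI)
  fix L
  define f where "f = (\<lambda>K. - Poly_Mapping.lookup (S K) L)"
  define g where "g = (\<lambda>J. Poly_Mapping.lookup (I_basis J) L)"
  have Pow: "Pow A = insert {} (subsystems A)" and notin: "{} \<notin> subsystems A" for A
    by (auto simp: subsystems_def)
  have [simp]: "f {} = 0" "g {} = 0"
    by (auto simp: f_def g_def S_def I_basis_def subsystems_def)
  have g: "g A = (\<Sum>T\<in>Pow A. (-1) ^ card T * f T)" if "finite A" for A
    using that notin
    by (simp add: Pow g_def f_def I_basis_def lookup_sum lookup_S)
  have "f K = (\<Sum>T\<in>Pow K. (-1) ^ card T * g T)"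
    by (rule inclusion_exclusion_symmetric[OF g assms])
  then have "- f K = (\<Sum>T\<in>subsystems K. (-1) ^ (card T + 1) * g T)"
    using assms notin by (simp add: Pow sum_negf)
  then show "Poly_Mapping.lookup (S K) L =
      Poly_Mapping.lookup (\<Sum>J\<in>subsystems K. scale ((-1) ^ (card J + 1)) (I_basis J)) L"
    by (simp add: f_def g_def lookup_sum)
qed

lemma I_expansion_unique:
  assumes r: "is_I_expansion N Q r" and r': "is_I_expansion N Q r'"
  shows "r = r'"
proof (rule ccontr)
  assume "r \<noteq> r'"
  let ?P = "subsystems (parties N)"
  define D where "D = {J. r J \<noteq> r' J}"
  have D: "D \<subseteq> ?P"
    using r r' unfolding is_I_expansion_def D_def by fastforce
  then have "finite D"
    by (rule finite_subset) simp
  moreover have "D \<noteq> {}"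
    using \<open>r \<noteq> r'\<close> by (auto simp: D_def)
  ultimately obtain J where J: "J \<in> D" "\<And>K. K \<in> D \<Longrightarrow> J \<subseteq> K \<Longrightarrow> J = K"
    by (metis finite_has_maximal)
  have fin: "finite K" if "K \<in> ?P" for K
    using that finite_subset[OF _ finite_parties] by (auto simp: subsystems_def)
  have "(\<Sum>K\<in>?P. scale (r K) (I_basis K)) = (\<Sum>K\<in>?P. scale (r' K) (I_basis K))"
    using r r' by (simp add: is_I_expansion_def)
  then have "Poly_Mapping.lookup (\<Sum>K\<in>?P. scale (r K) (I_basis K)) J =
      Poly_Mapping.lookup (\<Sum>K\<in>?P. scale (r' K) (I_basis K)) J"
    by simp
  then have "0 = (\<Sum>K\<in>?P. (r K - r' K) * Poly_Mapping.lookup (I_basis K) J)"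
    by (simp add: lookup_sum left_diff_distrib sum_subtractf)
  also have "\<dots> = (\<Sum>K\<in>?P. if K = J then (r J - r' J) * (-1) ^ (card J + 1) else 0)"
  proof (rule sum.cong)
    fix K assume K: "K \<in> ?P"
    have "r K = r' K" if "J \<subseteq> K" "K \<noteq> J"
      using J(2)[of K] that by (auto simp: D_def)
    moreover have "J \<noteq> {}"
      using J(1) D by (auto simp: subsystems_def)
    ultimately show "(r K - r' K) * Poly_Mapping.lookup (I_basis K) J =
        (if K = J then (r J - r' J) * (-1) ^ (card J + 1) else 0)"
      by (auto simp: lookup_I_basis[OF fin[OF K]] subsystems_def)
  qed simp
  also have "\<dots> = (r J - r' J) * (-1) ^ (card J + 1)"
    using J(1) D by auto
  finally show False
    using J(1) by (simp add: D_def)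
qed

lemma I_expansion_ex1:
  assumes "info_quantity N Q"
  shows "\<exists>!r. is_I_expansion N Q r"
proof -
  let ?P = "subsystems (parties N)"
  let ?q = "Poly_Mapping.lookup Q"
  define r where "r = (\<lambda>J. if J \<in> ?P
    then \<Sum>K\<in>{K \<in> ?P. J \<subseteq> K}. ?q K * (-1) ^ (card J + 1) else 0)"
  have fin: "finite K" if "K \<in> ?P" for K
    using that finite_subset[OF _ finite_parties] by (auto simp: subsystems_def)
  have "Q = (\<Sum>J\<in>?P. scale (r J) (I_basis J))"
  proof (rule poly_mapping_eqI)
    fix L
    let ?l = "\<lambda>A :: info_comb. Poly_Mapping.lookup A L"
    have sub: "{J \<in> ?P. J \<subseteq> K} = subsystems K" if "K \<in> ?P" for K
      using that by (auto simp: subsystems_def)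
    have "?q L = (\<Sum>K\<in>?P. if K = L then ?q L else 0)"
      using assms by (auto simp: info_quantity_def in_keys_iff)
    also have "\<dots> = (\<Sum>K\<in>?P. ?q K * ?l (S K))"
      by (rule sum.cong) (auto simp: lookup_S subsystems_def)
    also have "\<dots> = (\<Sum>K\<in>?P. \<Sum>J\<in>{J \<in> ?P. J \<subseteq> K}. ?q K * (-1) ^ (card J + 1) * ?l (I_basis J))"
      by (rule sum.cong[OF refl], subst S_eq_sum_I_basis[OF fin])
        (simp_all add: sub lookup_sum sum_distrib_left mult.assoc)
    also have "\<dots> = (\<Sum>J\<in>?P. \<Sum>K\<in>{K \<in> ?P. J \<subseteq> K}. ?q K * (-1) ^ (card J + 1) * ?l (I_basis J))"
      by (rule sum.swap_restrict) simp_all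
    also have "\<dots> = (\<Sum>J\<in>?P. r J * ?l (I_basis J))"
      by (rule sum.cong) (simp_all only: r_def sum_distrib_right if_True)
    finally show "?q L = ?l (\<Sum>J\<in>?P. scale (r J) (I_basis J))"
      by (simp add: lookup_sum)
  qed
  then have "is_I_expansion N Q r"
    by (simp add: is_I_expansion_def r_def)
  then show ?thesis
    using I_expansion_unique by blast
qed

end

(* In the I-basis, the coefficient of -I3(X:Y:Z|W) at a three-element set J is -1 if J meets each
   of X, Y and Z, and 0 otherwise. The three-party coefficients of a TF-compatible quantity are
   therefore sums of non-positive terms. If they all vanish, no J meets X, Y and Z in any of the
   terms, so each term has an empty argument among X, Y, Z and is zero. *)
theory Submission
  imports Defs
begin

text \<open>Expansions are linear in the quantity. The closure lemmas from here on let coefficients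
  be computed term by term, without touching the description operator in
  \<open>I_coeff\<close>.\<close>

lemma is_I_expansion_zero: "is_I_expansion N 0 (\<lambda>J. 0)"
  by (simp add: is_I_expansion_def poly_mapping_eq_iff lookup_sum fun_eq_iff)

lemma is_I_expansion_add:
  assumes "is_I_expansion N P p" "is_I_expansion N Q q"
  shows "is_I_expansion N (P + Q) (\<lambda>J. p J + q J)"
  using assms
  by (simp add: is_I_expansion_def poly_mapping_eq_iff lookup_sum lookup_add fun_eq_iff
      sum.distrib distrib_right)

lemma is_I_expansion_uminus:
  assumes "is_I_expansion N P p"
  shows "is_I_expansion N (- P) (\<lambda>J. - p J)"
  using assms
  by (simp add: is_I_expansion_def poly_mapping_eq_iff lookup_sum fun_eq_iff sum_negf)

lemma is_I_expansion_diff: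
  assumes "is_I_expansion N P p" "is_I_expansion N Q q"
  shows "is_I_expansion N (P - Q) (\<lambda>J. p J - q J)"
  using is_I_expansion_add[OF assms(1) is_I_expansion_uminus[OF assms(2)]] by simp

lemma is_I_expansion_sum_list:
  assumes "\<And>t. t \<in> set ts \<Longrightarrow> is_I_expansion N (f t) (c t)"
  shows "is_I_expansion N (\<Sum>t\<leftarrow>ts. f t) (\<lambda>J. \<Sum>t\<leftarrow>ts. c t J)"
  using assms by (induction ts) (auto intro: is_I_expansion_zero is_I_expansion_add)

text \<open>Inclusion-exclusion in the form of \<open>S_eq_sum_I_basis\<close>, padded with zero
  coefficients so that the sum runs over all subsystems of \<open>parties N\<close>.\<close>

lemma is_I_expansion_S:
  assumes "K \<subseteq> parties N"
  shows "is_I_expansion N (S K) (\<lambda>J. if J \<in> subsystems K then (-1) ^ (card J + 1) else 0)"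
proof -
  have sub: "subsystems K \<subseteq> subsystems (parties N)"
    using assms by (auto simp: subsystems_def)
  have "finite K"
    using assms by (rule finite_subset) simp
  then have "S K = (\<Sum>J\<in>subsystems K. scale ((-1) ^ (card J + 1)) (I_basis J))"
    by (rule S_eq_sum_I_basis)
  also have "\<dots> = (\<Sum>J\<in>subsystems (parties N).
      scale (if J \<in> subsystems K then (-1) ^ (card J + 1) else 0) (I_basis J))"
    using sub by (intro sum.mono_neutral_cong_left) (auto intro: poly_mapping_eqI)
  finally show ?thesis
    unfolding is_I_expansion_def using sub by (intro conjI) auto
qed

text \<open>Closed form for the I-basis coefficients of \<open>I3 X Y Z W\<close>. For pairwise
  disjoint \<open>X\<close>, \<open>Y\<close>, \<open>Z\<close> it vanishes on sets of fewer than
  three parties, and on sets of exactly three its sign is positive.\<close>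

definition I3_coeff :: "nat set \<Rightarrow> nat set \<Rightarrow> nat set \<Rightarrow> nat set \<Rightarrow> nat set \<Rightarrow> real" where
  "I3_coeff X Y Z W J =
    (if J \<subseteq> X \<union> Y \<union> Z \<union> W \<and> J \<inter> X \<noteq> {} \<and> J \<inter> Y \<noteq> {} \<and> J \<inter> Z \<noteq> {}
     then (-1) ^ (card J + 1) else 0)"

text \<open>Let a, b, c be 1 or 0 according to whether \<open>J\<close> misses \<open>X\<close>,
  \<open>Y\<close>, \<open>Z\<close> or not. For non-empty \<open>J\<close> inside the union of the
  four arguments, the eight terms add up, apart from the common sign, to 1 - a - b - c + ab + ac +
  bc - abc = (1 - a)(1 - b)(1 - c), which is 1 exactly if \<open>J\<close> meets all three.\<close>

lemma is_I_expansion_I3: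
  assumes "I3_admissible N X Y Z W"
  shows "is_I_expansion N (I3 X Y Z W) (I3_coeff X Y Z W)"
proof -
  define e :: "nat set \<Rightarrow> nat set \<Rightarrow> real"
    where "e = (\<lambda>K J. if J \<in> subsystems K then (-1) ^ (card J + 1) else 0)"
  have S: "is_I_expansion N (S K) (e K)" if "K \<subseteq> parties N" for K
    using is_I_expansion_S[OF that] by (simp add: e_def)
  have "is_I_expansion N (I3 X Y Z W) (\<lambda>J. e (X \<union> W) J + e (Y \<union> W) J + e (Z \<union> W) J
      + e (X \<union> Y \<union> Z \<union> W) J - e (X \<union> Y \<union> W) J - e (X \<union> Z \<union> W) J - e (Y \<union> Z \<union> W) J - e W J)"
    unfolding I3_def using assms
    by (intro is_I_expansion_add is_I_expansion_diff S) (auto simp: I3_admissible_def)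
  moreover have "e (X \<union> W) J + e (Y \<union> W) J + e (Z \<union> W) J + e (X \<union> Y \<union> Z \<union> W) J
      - e (X \<union> Y \<union> W) J - e (X \<union> Z \<union> W) J - e (Y \<union> Z \<union> W) J - e W J = I3_coeff X Y Z W J" for J
  proof (cases "J \<noteq> {} \<and> J \<subseteq> X \<union> Y \<union> Z \<union> W")
    case True
    \<comment> \<open>Containment in \<open>K\<close> is traded for missing its complement
      \<open>D\<close> within the union, so that all eight conditions become statements about
      \<open>J\<close> meeting \<open>X\<close>, \<open>Y\<close> and \<open>Z\<close>.\<close>
    have mem: "J \<in> subsystems K \<longleftrightarrow> J \<inter> D = {}"
      if "K \<union> D = X \<union> Y \<union> Z \<union> W" "K \<inter> D = {}" for K D
      using True that by (auto simp: subsystems_def)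
    have disj: "X \<inter> Y = {}" "X \<inter> Z = {}" "X \<inter> W = {}" "Y \<inter> Z = {}" "Y \<inter> W = {}" "Z \<inter> W = {}"
      using assms by (auto simp: I3_admissible_def)
    have
      "J \<in> subsystems (X \<union> W) \<longleftrightarrow> J \<inter> (Y \<union> Z) = {}"
      "J \<in> subsystems (Y \<union> W) \<longleftrightarrow> J \<inter> (X \<union> Z) = {}"
      "J \<in> subsystems (Z \<union> W) \<longleftrightarrow> J \<inter> (X \<union> Y) = {}"
      "J \<in> subsystems (X \<union> Y \<union> W) \<longleftrightarrow> J \<inter> Z = {}"
      "J \<in> subsystems (X \<union> Z \<union> W) \<longleftrightarrow> J \<inter> Y = {}"
      "J \<in> subsystems (Y \<union> Z \<union> W) \<longleftrightarrow> J \<inter> X = {}"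
      "J \<in> subsystems W \<longleftrightarrow> J \<inter> (X \<union> Y \<union> Z) = {}"
      "J \<in> subsystems (X \<union> Y \<union> Z \<union> W)"
             apply (rule mem; use disj in blast)+
      using True by (simp add: subsystems_def)
    with True show ?thesis
      by (simp add: e_def I3_coeff_def Int_Un_distrib)
  next
    case False
    \<comment> \<open>All eight arguments of \<open>S\<close> lie in the union, so every term
      vanishes separately.\<close>
    then have "J \<notin> subsystems K" if "K \<subseteq> X \<union> Y \<union> Z \<union> W" for K
      using that by (auto simp: subsystems_def)
    then have "e K J = 0" if "K \<subseteq> X \<union> Y \<union> Z \<union> W" for K
      using that by (simp add: e_def)
    moreover have "I3_coeff X Y Z W J = 0"
      using False by (auto simp: I3_coeff_def)
    ultimately show ?thesis
      by (simp add: le_supI1 le_supI2)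
  qed
  ultimately show ?thesis
    by simp
qed

text \<open>With one of these arguments empty, the eight terms cancel in pairs of opposite
  sign.\<close>

lemma I3_eq_0:
  assumes "X = {} \<or> Y = {} \<or> Z = {}"
  shows "I3 X Y Z W = 0"
  using assms by (auto simp: I3_def Un_ac)

theorem mainTheorem5:
  fixes N :: nat and Q :: info_comb
  assumes "info_quantity N Q"
    and "Q \<noteq> 0"
    and "TF_compatible N Q"
  shows "\<forall>R\<ge>3. \<not> R_balanced N R Q"
proof (intro allI impI notI)
  fix R :: nat
  assume R: "3 \<le> R" "R_balanced N R Q"
  obtain ts where adm: "\<And>X Y Z W. (X, Y, Z, W) \<in> set ts \<Longrightarrow> I3_admissible N X Y Z W"
    and Q: "Q = (\<Sum>(X, Y, Z, W)\<leftarrow>ts. - I3 X Y Z W)"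
    using assms(3) unfolding TF_compatible_def by fast
  define c where "c = (\<lambda>(X, Y, Z, W) J. - I3_coeff X Y Z W J)"
  have "is_I_expansion N Q (\<lambda>J. \<Sum>t\<leftarrow>ts. c t J)"
    unfolding Q by (rule is_I_expansion_sum_list)
      (auto simp: c_def intro!: is_I_expansion_uminus is_I_expansion_I3 adm)
  \<comment> \<open>Uniqueness of the expansion identifies \<open>I_coeff\<close> with the termwise
    sum, whichever list \<open>ts\<close> represents \<open>Q\<close>.\<close>
  then have coeff: "I_coeff N Q = (\<lambda>J. \<Sum>t\<leftarrow>ts. c t J)"
    unfolding I_coeff_def using I_expansion_unique by (intro the_equality) auto
  have "\<exists>t\<in>set ts. (case t of (X, Y, Z, W) \<Rightarrow> - I3 X Y Z W) \<noteq> 0"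
  proof (rule ccontr)
    assume "\<not> ?thesis"
    then have "(\<Sum>(X, Y, Z, W)\<leftarrow>ts. - I3 X Y Z W) = (\<Sum>t\<leftarrow>ts. 0)"
      by (intro arg_cong[where f = sum_list] map_cong) auto
    also have "\<dots> = 0"
      by simp
    finally show False
      using \<open>Q \<noteq> 0\<close> Q by blast
  qed
  then obtain X Y Z W where t: "(X, Y, Z, W) \<in> set ts" and "I3 X Y Z W \<noteq> 0"
    by auto
  then obtain x y z where xyz: "x \<in> X" "y \<in> Y" "z \<in> Z"
    using I3_eq_0 by blast
  \<comment> \<open>One party from each argument of a non-zero term. Disjointness makes these three
    distinct, so \<open>J\<close> has size 3, within the range of \<open>R_balanced\<close> since
    \<open>R\<close> is at least 3.\<close>
  define J where "J = {x, y, z}"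
  have dist: "x \<noteq> y" "x \<noteq> z" "y \<noteq> z" and sub: "J \<in> subsystems (parties N)"
    using adm[OF t] xyz by (auto simp: I3_admissible_def J_def subsystems_def)
  then have card: "card J = 3"
    by (simp add: J_def)
  \<comment> \<open>At size 3 the sign is (-1)^4 = 1, so every term of the list, not only the chosen
    one, contributes 0 or -1 at this \<open>J\<close>.\<close>
  then have nonneg: "0 \<le> - c s J" for s
    by (cases s) (simp add: c_def I3_coeff_def)
  have "(\<Sum>s\<leftarrow>ts. c s J) = 0"
    using R card sub by (simp add: R_balanced_def coeff)
  then have "(\<Sum>s\<leftarrow>ts. - c s J) = 0"
    using uminus_sum_list_map[of "\<lambda>s. c s J" ts] by (simp add: o_def)
  \<comment> \<open>Terms of equal sign cannot cancel: a vanishing sum forces each of them to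
    vanish, whereas the chosen term contributes -1.\<close>
  then have "\<forall>v\<in>set (map (\<lambda>s. - c s J) ts). v = 0"
    using nonneg by (subst (asm) sum_list_nonneg_eq_0_iff) auto
  with t have "c (X, Y, Z, W) J = 0"
    by force
  moreover have "c (X, Y, Z, W) J = -1"
    using xyz card by (auto simp: c_def I3_coeff_def J_def)
  ultimately show False
    by simp
qed

end
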